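(* For every integer $n\geq 4$, the homomorphism $\kappa:\Upsilon_n\to J_n$ defined on generators by $$\kappa(\sigma_i)=s_{i,i+1}\quad(1\le i\le n-1),\qquad \kappa(\zeta)=s_{1,n}s_{2,n},$$ is injective.
   Context: The full round twin group $\Upsilon_n$ is the group with generators $\sigma_1,\ldots,\sigma_{n-1}$ and $\zeta$ and relations $$\sigma_i^2=1\quad (1\le i\le n-1),\qquad \sigma_i\sigma_j=\sigma_j\sigma_i\quad (1\le i,j\le n-1,\ |i-j|>1),\qquad \sigma_i\zeta=\zeta\sigma_{i+1}\quad (1\le i< n-1).$$ (Geometrically, it consists of fixed-end homotopy classes of paths, in the space $Q_{n+1}$ of configurations of $n+1$ ordered points on $S^1$ with no three coinciding and the last one fixed at $\infty$, that start at a basepoint consisting of distinct points $x_1,\dots,x_n\in S^1\setminus\{\infty\}$ and end at a configuration obtained from it by permuting $x_1,\dots,x_n$; $\sigma_i$ interchanges the neighbouring points in positions $i$ and $i+1$, and $\zeta$ passes an extreme point through infinity to the other end.) The full cactus group $J_n$ is the group with generators $s_{p,q}$, $1\leq p<q\leq n$, and relations $$s_{p,q}^2=1,$$ $$s_{p,q}s_{m,r}=s_{m,r}s_{p,q}\quad\text{if } [p,q]\cap[m,r]=\emptyset,$$ $$s_{p,q}s_{m,r}=s_{p+q-r,\,p+q-m}\,s_{p,q}\quad\text{if } [m,r]\subset[p,q].$$ The assignment $\kappa$ above respects the relations of $\Upsilon_n$ and so defines a homomorphism. *)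

theory Defs
  imports "HOL-Algebra.Group"
begin

section \<open>Groups given by generators and relations\<close>

text \<open>
  A letter \<open>(True, s)\<close> stands for the generator \<open>s\<close>, and \<open>(False, s)\<close> for its formal inverse.
  A relation \<open>u = v\<close> is the pair of words \<open>(u, v)\<close>. The group presented by generators \<open>S\<close>
  and relations \<open>R\<close> is the quotient of the words over \<open>S\<close> by the smallest congruence that
  contains \<open>R\<close> and the free cancellations.
\<close>

type_synonym 'a word = "(bool \<times> 'a) list"

definition words :: "'a set \<Rightarrow> 'a word set" where
  "words S = lists (UNIV \<times> S)"

inductive word_eq :: "'a set \<Rightarrow> ('a word \<times> 'a word) set \<Rightarrow> 'a word \<Rightarrow> 'a word \<Rightarrow> bool"
  for S R where
  refl: "w \<in> words S \<Longrightarrow> word_eq S R w w"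
| sym: "word_eq S R u v \<Longrightarrow> word_eq S R v u"
| trans: "word_eq S R u v \<Longrightarrow> word_eq S R v w \<Longrightarrow> word_eq S R u w"
| append: "word_eq S R u v \<Longrightarrow> word_eq S R u' v' \<Longrightarrow> word_eq S R (u @ u') (v @ v')"
| cancel: "s \<in> S \<Longrightarrow> word_eq S R [(b, s), (\<not> b, s)] []"
| rel: "(u, v) \<in> R \<Longrightarrow> word_eq S R u v"

definition word_rel :: "'a set \<Rightarrow> ('a word \<times> 'a word) set \<Rightarrow> ('a word \<times> 'a word) set" where
  "word_rel S R = {(u, v). word_eq S R u v}"

definition presented_group :: "'a set \<Rightarrow> ('a word \<times> 'a word) set \<Rightarrow> 'a word set monoid" where
  "presented_group S R =
    \<lparr>carrier = words S // word_rel S R,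
     mult = (\<lambda>X Y. \<Union>x\<in>X. \<Union>y\<in>Y. word_rel S R `` {x @ y}),
     one = word_rel S R `` {[]}\<rparr>"

definition presented_gen :: "'a set \<Rightarrow> ('a word \<times> 'a word) set \<Rightarrow> 'a \<Rightarrow> 'a word set" where
  "presented_gen S R s = word_rel S R `` {[(True, s)]}"

text \<open>
  The value in \<open>G\<close> of a word under an assignment \<open>f\<close> of its generators, and the map on classes of
  words that it induces. The latter is meaningful whenever \<open>f\<close> respects the relations; see
  \<open>induced_hom_hom\<close> below.
\<close>

definition word_val :: "('g, 'm) monoid_scheme \<Rightarrow> ('a \<Rightarrow> 'g) \<Rightarrow> 'a word \<Rightarrow> 'g" where
  "word_val G f w =
    foldr (\<lambda>(b, s) g. (if b then f s else inv\<^bsub>G\<^esub> f s) \<otimes>\<^bsub>G\<^esub> g) w \<one>\<^bsub>G\<^esub>"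

definition induced_hom :: "('g, 'm) monoid_scheme \<Rightarrow> ('a \<Rightarrow> 'g) \<Rightarrow> 'a word set \<Rightarrow> 'g" where
  "induced_hom G f X = the_elem (word_val G f ` X)"

abbreviation gens_word :: "'a list \<Rightarrow> 'a word" where
  "gens_word ss \<equiv> map (Pair True) ss"


section \<open>The full round twin group\<close>

datatype twin_gen = Sg nat | Zt

definition twin_gens :: "nat \<Rightarrow> twin_gen set" where
  "twin_gens n = insert Zt {Sg i |i. 1 \<le> i \<and> i \<le> n - 1}"

definition twin_rels :: "nat \<Rightarrow> (twin_gen word \<times> twin_gen word) set" where
  "twin_rels n =
     {(gens_word [Sg i, Sg i], []) |i. 1 \<le> i \<and> i \<le> n - 1}
   \<union> {(gens_word [Sg i, Sg j], gens_word [Sg j, Sg i]) |i j.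
        1 \<le> i \<and> i \<le> n - 1 \<and> 1 \<le> j \<and> j \<le> n - 1 \<and> \<bar>int i - int j\<bar> > 1}
   \<union> {(gens_word [Sg i, Zt], gens_word [Zt, Sg (i + 1)]) |i. 1 \<le> i \<and> i < n - 1}"

definition full_round_twin_group :: "nat \<Rightarrow> twin_gen word set monoid" where
  "full_round_twin_group n = presented_group (twin_gens n) (twin_rels n)"

definition sigma :: "nat \<Rightarrow> nat \<Rightarrow> twin_gen word set" where
  "sigma n i = presented_gen (twin_gens n) (twin_rels n) (Sg i)"

definition zeta :: "nat \<Rightarrow> twin_gen word set" where
  "zeta n = presented_gen (twin_gens n) (twin_rels n) Zt"


section \<open>The full cactus group\<close>

text \<open>The generator \<open>s\<^sub>p\<^sub>,\<^sub>q\<close> is indexed by the pair \<open>(p, q)\<close>.\<close>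

definition cactus_gens :: "nat \<Rightarrow> (nat \<times> nat) set" where
  "cactus_gens n = {(p, q). 1 \<le> p \<and> p < q \<and> q \<le> n}"

definition cactus_rels :: "nat \<Rightarrow> ((nat \<times> nat) word \<times> (nat \<times> nat) word) set" where
  "cactus_rels n =
     {(gens_word [(p, q), (p, q)], []) |p q. (p, q) \<in> cactus_gens n}
   \<union> {(gens_word [(p, q), (m, r)], gens_word [(m, r), (p, q)]) |p q m r.
        (p, q) \<in> cactus_gens n \<and> (m, r) \<in> cactus_gens n \<and> {p..q} \<inter> {m..r} = {}}
   \<union> {(gens_word [(p, q), (m, r)], gens_word [(p + q - r, p + q - m), (p, q)]) |p q m r.
        (p, q) \<in> cactus_gens n \<and> (m, r) \<in> cactus_gens n \<and> {m..r} \<subseteq> {p..q}}"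

definition full_cactus_group :: "nat \<Rightarrow> (nat \<times> nat) word set monoid" where
  "full_cactus_group n = presented_group (cactus_gens n) (cactus_rels n)"

definition cactus :: "nat \<Rightarrow> nat \<Rightarrow> nat \<Rightarrow> (nat \<times> nat) word set" where
  "cactus n p q = presented_gen (cactus_gens n) (cactus_rels n) (p, q)"


section \<open>The homomorphism\<close>

primrec kappa_gen :: "nat \<Rightarrow> twin_gen \<Rightarrow> (nat \<times> nat) word set" where
  "kappa_gen n (Sg i) = cactus n i (i + 1)"
| "kappa_gen n Zt = cactus n 1 n \<otimes>\<^bsub>full_cactus_group n\<^esub> cactus n 2 n"

definition kappa :: "nat \<Rightarrow> twin_gen word set \<Rightarrow> (nat \<times> nat) word set" where
  "kappa n = induced_hom (full_cactus_group n) (kappa_gen n)"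


section \<open>Well-definedness\<close>

lemma words_append [simp]: "u @ v \<in> words S \<longleftrightarrow> u \<in> words S \<and> v \<in> words S"
  by (auto simp: words_def)

lemma words_Nil [simp]: "[] \<in> words S"
  by (simp add: words_def)

lemma words_Cons [simp]: "(b, s) # w \<in> words S \<longleftrightarrow> s \<in> S \<and> w \<in> words S"
  by (auto simp: words_def)

lemma word_eq_words:
  assumes "R \<subseteq> words S \<times> words S" "word_eq S R u v"
  shows "u \<in> words S \<and> v \<in> words S"
  using assms(2,1) by (induction rule: word_eq.induct) auto

lemma equiv_word_rel:
  assumes "R \<subseteq> words S \<times> words S"
  shows "equiv (words S) (word_rel S R)"
  by (rule equivI)
    (auto simp: word_rel_def refl_on_def sym_def trans_def
      intro: word_eq.intros dest: word_eq_words[OF assms])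

lemma word_class_eq_iff:
  assumes "R \<subseteq> words S \<times> words S" "u \<in> words S" "v \<in> words S"
  shows "word_rel S R `` {u} = word_rel S R `` {v} \<longleftrightarrow> word_eq S R u v"
  using eq_equiv_class_iff[OF equiv_word_rel[OF assms(1)] assms(2,3)] by (simp add: word_rel_def)

lemma carrier_presented_group:
  "carrier (presented_group S R) = {word_rel S R `` {w} |w. w \<in> words S}"
  by (auto simp: presented_group_def quotient_def)

lemma one_presented_group: "\<one>\<^bsub>presented_group S R\<^esub> = word_rel S R `` {[]}"
  by (simp add: presented_group_def)

lemma mult_presented_group:
  assumes R: "R \<subseteq> words S \<times> words S" and u: "u \<in> words S" and v: "v \<in> words S"
  shows "word_rel S R `` {u} \<otimes>\<^bsub>presented_group S R\<^esub> word_rel S R `` {v} = word_rel S R `` {u @ v}"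
proof -
  have eq: "word_rel S R `` {x @ y} = word_rel S R `` {u @ v}"
    if "x \<in> word_rel S R `` {u}" "y \<in> word_rel S R `` {v}" for x y
  proof -
    have "word_eq S R u x" "word_eq S R v y" using that by (auto simp: word_rel_def)
    then have "word_eq S R (x @ y) (u @ v)" by (blast intro: word_eq.intros)
    with word_eq_words[OF R this] show ?thesis using word_class_eq_iff[OF R] by blast
  qed
  have mem: "u \<in> word_rel S R `` {u}" "v \<in> word_rel S R `` {v}"
    using u v by (auto simp: word_rel_def intro: word_eq.refl)
  have "(\<Union>x\<in>word_rel S R `` {u}. \<Union>y\<in>word_rel S R `` {v}. word_rel S R `` {x @ y}) =
      (\<Union>x\<in>word_rel S R `` {u}. \<Union>y\<in>word_rel S R `` {v}. word_rel S R `` {u @ v})"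
    by (intro SUP_cong HOL.refl eq)
  also have "\<dots> = word_rel S R `` {u @ v}"
    using mem by blast
  finally show ?thesis by (simp add: presented_group_def)
qed

definition word_inv :: "'a word \<Rightarrow> 'a word" where
  "word_inv w = rev (map (\<lambda>(b, s). (\<not> b, s)) w)"

lemma word_inv_words: "w \<in> words S \<Longrightarrow> word_inv w \<in> words S"
  by (auto simp: word_inv_def words_def)

lemma word_inv_cancel: "w \<in> words S \<Longrightarrow> word_eq S R (word_inv w @ w) []"
proof (induction w)
  case Nil
  then show ?case by (simp add: word_inv_def word_eq.refl)
next
  case (Cons a w)
  obtain b s where a: "a = (b, s)" by (cases a)
  have s: "s \<in> S" and w: "w \<in> words S" using Cons.prems a by auto
  have "word_eq S R [(\<not> b, s), (\<not> \<not> b, s)] []" by (rule word_eq.cancel) fact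
  then have "word_eq S R ([(\<not> b, s), (b, s)] @ w) ([] @ w)"
    by (intro word_eq.append[OF _ word_eq.refl[OF w]]) simp
  then have "word_eq S R (word_inv w @ [(\<not> b, s), (b, s)] @ w) (word_inv w @ [] @ w)"
    by (rule word_eq.append[OF word_eq.refl[OF word_inv_words[OF w]]])
  with Cons.IH[OF w] have "word_eq S R (word_inv w @ [(\<not> b, s), (b, s)] @ w) []"
    by (auto intro: word_eq.trans)
  then show ?case by (simp add: a word_inv_def)
qed

lemma group_presented_group:
  assumes R: "R \<subseteq> words S \<times> words S"
  shows "group (presented_group S R)"
proof (rule groupI)
  fix X assume "X \<in> carrier (presented_group S R)"
  then obtain w where w: "w \<in> words S" "X = word_rel S R `` {w}"
    by (auto simp: carrier_presented_group)
  then show "\<one>\<^bsub>presented_group S R\<^esub> \<otimes>\<^bsub>presented_group S R\<^esub> X = X"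
    using mult_presented_group[OF R words_Nil w(1)] by (simp add: one_presented_group)
  have "word_rel S R `` {word_inv w} \<otimes>\<^bsub>presented_group S R\<^esub> X = \<one>\<^bsub>presented_group S R\<^esub>"
    using mult_presented_group[OF R word_inv_words[OF w(1)] w(1)] w
      word_class_eq_iff[OF R] word_inv_cancel[OF w(1)] word_inv_words[OF w(1)]
    by (simp add: one_presented_group)
  then show "\<exists>Y\<in>carrier (presented_group S R). Y \<otimes>\<^bsub>presented_group S R\<^esub> X = \<one>\<^bsub>presented_group S R\<^esub>"
    using word_inv_words[OF w(1)] by (auto simp: carrier_presented_group)
next
  show "\<one>\<^bsub>presented_group S R\<^esub> \<in> carrier (presented_group S R)"
    using words_Nil[of S] unfolding carrier_presented_group one_presented_group by blast
next
  fix X Y assume "X \<in> carrier (presented_group S R)" "Y \<in> carrier (presented_group S R)"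
  then obtain u v where "u \<in> words S" "v \<in> words S"
      "X = word_rel S R `` {u}" "Y = word_rel S R `` {v}"
    by (auto simp: carrier_presented_group)
  then show "X \<otimes>\<^bsub>presented_group S R\<^esub> Y \<in> carrier (presented_group S R)"
    using mult_presented_group[OF R] words_append[of u v S]
    unfolding carrier_presented_group by blast
next
  fix X Y Z
  assume "X \<in> carrier (presented_group S R)" "Y \<in> carrier (presented_group S R)"
    "Z \<in> carrier (presented_group S R)"
  then obtain u v w where "u \<in> words S" "v \<in> words S" "w \<in> words S"
      "X = word_rel S R `` {u}" "Y = word_rel S R `` {v}" "Z = word_rel S R `` {w}"
    by (auto simp: carrier_presented_group)
  then show "X \<otimes>\<^bsub>presented_group S R\<^esub> Y \<otimes>\<^bsub>presented_group S R\<^esub> Z =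
      X \<otimes>\<^bsub>presented_group S R\<^esub> (Y \<otimes>\<^bsub>presented_group S R\<^esub> Z)"
    by (simp add: mult_presented_group[OF R])
qed

lemma word_val_Nil [simp]: "word_val G f [] = \<one>\<^bsub>G\<^esub>"
  by (simp add: word_val_def)

lemma word_val_Cons [simp]:
  "word_val G f ((b, s) # w) = (if b then f s else inv\<^bsub>G\<^esub> f s) \<otimes>\<^bsub>G\<^esub> word_val G f w"
  by (simp add: word_val_def)

lemma word_val_closed:
  assumes "group G" "f \<in> S \<rightarrow> carrier G" "w \<in> words S"
  shows "word_val G f w \<in> carrier G"
proof -
  interpret group G by fact
  show ?thesis using assms(3)
  proof (induction w)
    case (Cons a w)
    then show ?case using assms(2) by (cases a) (auto simp: Pi_iff)
  qed simp
qed

lemma word_val_append: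
  assumes "group G" "f \<in> S \<rightarrow> carrier G" "u \<in> words S" "v \<in> words S"
  shows "word_val G f (u @ v) = word_val G f u \<otimes>\<^bsub>G\<^esub> word_val G f v"
proof -
  interpret group G by fact
  show ?thesis using assms(3)
  proof (induction u)
    case Nil
    then show ?case using word_val_closed[OF assms(1,2,4)] by simp
  next
    case (Cons a u)
    obtain b s where a: "a = (b, s)" by (cases a)
    then have "f s \<in> carrier G" "u \<in> words S" using Cons.prems assms(2) by auto
    then show ?case
      using Cons.IH word_val_closed[OF assms(1,2)] assms(4) by (simp add: a m_assoc)
  qed
qed

lemma word_val_word_eq:
  assumes G: "group G" and f: "f \<in> S \<rightarrow> carrier G" and R: "R \<subseteq> words S \<times> words S"
    and fR: "\<And>u v. (u, v) \<in> R \<Longrightarrow> word_val G f u = word_val G f v"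
    and uv: "word_eq S R u v"
  shows "word_val G f u = word_val G f v"
  using uv
proof (induction rule: word_eq.induct)
  case (append u v u' v')
  then show ?case
    using word_eq_words[OF R append.hyps(1)] word_eq_words[OF R append.hyps(2)]
    by (simp add: word_val_append[OF G f])
next
  case (cancel s b)
  interpret group G by fact
  have "f s \<in> carrier G" using cancel f by auto
  then show ?case by simp
qed (auto simp: fR)

lemma induced_hom_class:
  assumes "group G" "f \<in> S \<rightarrow> carrier G" "R \<subseteq> words S \<times> words S"
    and "\<And>u v. (u, v) \<in> R \<Longrightarrow> word_val G f u = word_val G f v"
    and w: "w \<in> words S"
  shows "induced_hom G f (word_rel S R `` {w}) = word_val G f w"
proof -
  have ne: "word_rel S R `` {w} \<noteq> {}"
    using word_eq.refl[OF w] by (auto simp: word_rel_def)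
  have eq: "word_val G f v = word_val G f w" if "v \<in> word_rel S R `` {w}" for v
    using word_val_word_eq[OF assms(1-4), of w v] that by (simp add: word_rel_def)
  have "word_val G f ` (word_rel S R `` {w}) = (\<lambda>_. word_val G f w) ` (word_rel S R `` {w})"
    by (intro image_cong HOL.refl eq)
  also have "\<dots> = {word_val G f w}"
    using ne by (simp add: image_constant_conv)
  finally have "word_val G f ` (word_rel S R `` {w}) = {word_val G f w}" .
  then show ?thesis by (simp add: induced_hom_def)
qed

lemma induced_hom_hom:
  assumes "group G" "f \<in> S \<rightarrow> carrier G" "R \<subseteq> words S \<times> words S"
    and "\<And>u v. (u, v) \<in> R \<Longrightarrow> word_val G f u = word_val G f v"
  shows "induced_hom G f \<in> hom (presented_group S R) G"
proof (rule homI)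
  fix X assume "X \<in> carrier (presented_group S R)"
  then obtain u where "u \<in> words S" "X = word_rel S R `` {u}"
    by (auto simp: carrier_presented_group)
  then show "induced_hom G f X \<in> carrier G"
    by (simp add: induced_hom_class[OF assms] word_val_closed[OF assms(1,2)])
next
  fix X Y assume "X \<in> carrier (presented_group S R)" "Y \<in> carrier (presented_group S R)"
  then obtain u v where "u \<in> words S" "v \<in> words S"
      "X = word_rel S R `` {u}" "Y = word_rel S R `` {v}"
    by (auto simp: carrier_presented_group)
  then show "induced_hom G f (X \<otimes>\<^bsub>presented_group S R\<^esub> Y) =
      induced_hom G f X \<otimes>\<^bsub>G\<^esub> induced_hom G f Y"
    by (simp add: mult_presented_group[OF assms(3)] induced_hom_class[OF assms]
        word_val_append[OF assms(1,2)])
qed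

lemma induced_hom_gen:
  assumes "group G" "f \<in> S \<rightarrow> carrier G" "R \<subseteq> words S \<times> words S"
    and "\<And>u v. (u, v) \<in> R \<Longrightarrow> word_val G f u = word_val G f v"
    and s: "s \<in> S"
  shows "induced_hom G f (presented_gen S R s) = f s"
proof -
  interpret group G by fact
  have "f s \<in> carrier G" using s assms(2) by auto
  then show ?thesis
    using s by (simp add: presented_gen_def induced_hom_class[OF assms(1-4)])
qed

lemma twin_rels_words: "twin_rels n \<subseteq> words (twin_gens n) \<times> words (twin_gens n)"
  by (auto simp: twin_rels_def twin_gens_def)

lemma cactus_rels_words: "cactus_rels n \<subseteq> words (cactus_gens n) \<times> words (cactus_gens n)"
  by (auto simp: cactus_rels_def cactus_gens_def)

lemma group_full_round_twin_group: "group (full_round_twin_group n)"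
  unfolding full_round_twin_group_def by (rule group_presented_group[OF twin_rels_words])

lemma group_full_cactus_group: "group (full_cactus_group n)"
  unfolding full_cactus_group_def by (rule group_presented_group[OF cactus_rels_words])

lemma cactus_closed: "(p, q) \<in> cactus_gens n \<Longrightarrow> cactus n p q \<in> carrier (full_cactus_group n)"
  by (auto simp: full_cactus_group_def carrier_presented_group cactus_def presented_gen_def)

lemma cactus_mult:
  assumes "(p, q) \<in> cactus_gens n" "(m, r) \<in> cactus_gens n"
  shows "cactus n p q \<otimes>\<^bsub>full_cactus_group n\<^esub> cactus n m r =
    word_rel (cactus_gens n) (cactus_rels n) `` {gens_word [(p, q), (m, r)]}"
  using assms mult_presented_group[OF cactus_rels_words, of "[(True, p, q)]" n "[(True, m, r)]"]
  by (simp add: full_cactus_group_def cactus_def presented_gen_def)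

lemma one_full_cactus_group:
  "\<one>\<^bsub>full_cactus_group n\<^esub> = word_rel (cactus_gens n) (cactus_rels n) `` {[]}"
  by (simp add: full_cactus_group_def one_presented_group)

lemma cactus_rel_class:
  assumes "(u, v) \<in> cactus_rels n"
  shows "word_rel (cactus_gens n) (cactus_rels n) `` {u} =
    word_rel (cactus_gens n) (cactus_rels n) `` {v}"
proof -
  have "u \<in> words (cactus_gens n)" "v \<in> words (cactus_gens n)"
    using subsetD[OF cactus_rels_words assms] by auto
  from word_class_eq_iff[OF cactus_rels_words this] show ?thesis
    using word_eq.rel[OF assms] by simp
qed

lemma cactus_involution:
  assumes "(p, q) \<in> cactus_gens n"
  shows "cactus n p q \<otimes>\<^bsub>full_cactus_group n\<^esub> cactus n p q = \<one>\<^bsub>full_cactus_group n\<^esub>"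
proof -
  have "(gens_word [(p, q), (p, q)], []) \<in> cactus_rels n"
    using assms unfolding cactus_rels_def by blast
  then show ?thesis
    unfolding cactus_mult[OF assms assms] one_full_cactus_group by (rule cactus_rel_class)
qed

lemma cactus_commute:
  assumes "(p, q) \<in> cactus_gens n" "(m, r) \<in> cactus_gens n" "{p..q} \<inter> {m..r} = {}"
  shows "cactus n p q \<otimes>\<^bsub>full_cactus_group n\<^esub> cactus n m r =
    cactus n m r \<otimes>\<^bsub>full_cactus_group n\<^esub> cactus n p q"
proof -
  have "(gens_word [(p, q), (m, r)], gens_word [(m, r), (p, q)]) \<in> cactus_rels n"
    using assms unfolding cactus_rels_def by blast
  then show ?thesis
    unfolding cactus_mult[OF assms(1,2)] cactus_mult[OF assms(2,1)] by (rule cactus_rel_class)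
qed

lemma cactus_reflect:
  assumes "(p, q) \<in> cactus_gens n" "(m, r) \<in> cactus_gens n" "{m..r} \<subseteq> {p..q}"
  shows "cactus n p q \<otimes>\<^bsub>full_cactus_group n\<^esub> cactus n m r =
    cactus n (p + q - r) (p + q - m) \<otimes>\<^bsub>full_cactus_group n\<^esub> cactus n p q"
proof -
  have "(gens_word [(p, q), (m, r)], gens_word [(p + q - r, p + q - m), (p, q)]) \<in> cactus_rels n"
    using assms unfolding cactus_rels_def by blast
  moreover have "(p + q - r, p + q - m) \<in> cactus_gens n"
    using assms by (auto simp: cactus_gens_def)
  ultimately show ?thesis
    unfolding cactus_mult[OF assms(1,2)] cactus_mult[OF \<open>(p + q - r, _) \<in> _\<close> assms(1)]
    by (intro cactus_rel_class)
qed

lemma kappa_gen_closed: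
  assumes "3 \<le> n"
  shows "kappa_gen n \<in> twin_gens n \<rightarrow> carrier (full_cactus_group n)"
proof -
  interpret group "full_cactus_group n" by (rule group_full_cactus_group)
  have "cactus n 1 n \<in> carrier (full_cactus_group n)" "cactus n 2 n \<in> carrier (full_cactus_group n)"
    using assms by (auto intro!: cactus_closed simp: cactus_gens_def)
  moreover have "cactus n i (i + 1) \<in> carrier (full_cactus_group n)"
    if "1 \<le> i" "i \<le> n - 1" for i
    using that assms by (auto intro!: cactus_closed simp: cactus_gens_def)
  ultimately show ?thesis by (auto simp: twin_gens_def)
qed

lemma kappa_gen_rels:
  assumes n: "3 \<le> n" and uv: "(u, v) \<in> twin_rels n"
  shows "word_val (full_cactus_group n) (kappa_gen n) u =
    word_val (full_cactus_group n) (kappa_gen n) v"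
proof -
  let ?J = "full_cactus_group n"
  interpret J: group ?J by (rule group_full_cactus_group)
  have G: "(i, i + 1) \<in> cactus_gens n" if "1 \<le> i" "i \<le> n - 1" for i
    using that n by (auto simp: cactus_gens_def)
  have C: "cactus n i (i + 1) \<in> carrier ?J" if "1 \<le> i" "i \<le> n - 1" for i
    using G[OF that] by (rule cactus_closed)
  have G1: "(1, n) \<in> cactus_gens n" and G2: "(2, n) \<in> cactus_gens n"
    using n by (auto simp: cactus_gens_def)
  note C1 = cactus_closed[OF G1] and C2 = cactus_closed[OF G2]
  consider (sq) i where "1 \<le> i" "i \<le> n - 1" "u = gens_word [Sg i, Sg i]" "v = []"
    | (comm) i j where "1 \<le> i" "i \<le> n - 1" "1 \<le> j" "j \<le> n - 1" "\<bar>int i - int j\<bar> > 1"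
        "u = gens_word [Sg i, Sg j]" "v = gens_word [Sg j, Sg i]"
    | (shift) i where "1 \<le> i" "i < n - 1"
        "u = gens_word [Sg i, Zt]" "v = gens_word [Zt, Sg (i + 1)]"
    using uv unfolding twin_rels_def by blast
  then show ?thesis
  proof cases
    case sq
    then show ?thesis using cactus_involution[OF G] C by simp
  next
    case comm
    then have "{i..i + 1} \<inter> {j..j + 1} = {}" by auto
    from cactus_commute[OF G[OF comm(1,2)] G[OF comm(3,4)] this]
    show ?thesis using C[OF comm(1,2)] C[OF comm(3,4)] comm(6,7) by simp
  next
    case shift
    have g: "(i + 1, i + 1 + 1) \<in> cactus_gens n" and g': "(n - i, n - i + 1) \<in> cactus_gens n"
      using shift n by (auto simp: cactus_gens_def)
    note c = cactus_closed[OF g] and c' = cactus_closed[OF g']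
    have ci: "cactus n i (i + 1) \<in> carrier ?J" using shift by (intro C) auto
    have e2: "2 + n - (i + 1 + 1) = n - i" "2 + n - (i + 1) = n - i + 1"
      and e1: "1 + n - (n - i + 1) = i" "1 + n - (n - i) = i + 1"
      using shift by auto
    have sub2: "{i + 1..i + 1 + 1} \<subseteq> {2..n}" and sub1: "{n - i..n - i + 1} \<subseteq> {1..n}"
      using shift by auto
    have r2: "cactus n 2 n \<otimes>\<^bsub>?J\<^esub> cactus n (i + 1) (i + 1 + 1) =
        cactus n (n - i) (n - i + 1) \<otimes>\<^bsub>?J\<^esub> cactus n 2 n"
      using cactus_reflect[OF G2 g sub2] unfolding e2 .
    have r1: "cactus n 1 n \<otimes>\<^bsub>?J\<^esub> cactus n (n - i) (n - i + 1) =
        cactus n i (i + 1) \<otimes>\<^bsub>?J\<^esub> cactus n 1 n"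
      using cactus_reflect[OF G1 g' sub1] unfolding e1 .
    have "(cactus n 1 n \<otimes>\<^bsub>?J\<^esub> cactus n 2 n) \<otimes>\<^bsub>?J\<^esub> cactus n (i + 1) (i + 1 + 1) =
        cactus n 1 n \<otimes>\<^bsub>?J\<^esub> (cactus n (n - i) (n - i + 1) \<otimes>\<^bsub>?J\<^esub> cactus n 2 n)"
      using r2 C1 C2 c by (simp only: J.m_assoc)
    also have "\<dots> = (cactus n i (i + 1) \<otimes>\<^bsub>?J\<^esub> cactus n 1 n) \<otimes>\<^bsub>?J\<^esub> cactus n 2 n"
      using r1 C1 C2 c' by (simp only: J.m_assoc[symmetric])
    also have "\<dots> = cactus n i (i + 1) \<otimes>\<^bsub>?J\<^esub> (cactus n 1 n \<otimes>\<^bsub>?J\<^esub> cactus n 2 n)"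
      using C1 C2 ci by (simp only: J.m_assoc)
    finally show ?thesis using shift C1 C2 c ci by simp
  qed
qed

lemma kappa_hom:
  "3 \<le> n \<Longrightarrow> kappa n \<in> hom (full_round_twin_group n) (full_cactus_group n)"
  unfolding kappa_def full_round_twin_group_def
  by (intro induced_hom_hom group_full_cactus_group kappa_gen_closed twin_rels_words kappa_gen_rels)

lemma kappa_sigma:
  assumes "3 \<le> n" "1 \<le> i" "i \<le> n - 1"
  shows "kappa n (sigma n i) = cactus n i (i + 1)"
proof -
  have "Sg i \<in> twin_gens n" using assms by (auto simp: twin_gens_def)
  from induced_hom_gen[OF group_full_cactus_group kappa_gen_closed[OF assms(1)] twin_rels_words
      kappa_gen_rels[OF assms(1)] this]
  show ?thesis by (simp add: kappa_def sigma_def)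
qed

lemma kappa_zeta:
  assumes "3 \<le> n"
  shows "kappa n (zeta n) = cactus n 1 n \<otimes>\<^bsub>full_cactus_group n\<^esub> cactus n 2 n"
proof -
  have "Zt \<in> twin_gens n" by (auto simp: twin_gens_def)
  from induced_hom_gen[OF group_full_cactus_group kappa_gen_closed[OF assms(1)] twin_rels_words
      kappa_gen_rels[OF assms(1)] this]
  show ?thesis by (simp add: kappa_def zeta_def)
qed

end

theory Submission
  imports Defs "HOL-Algebra.Coset"
begin

text \<open>
  Mostovoy's map sends \<open>s\<^sub>p\<^sub>,\<^sub>q\<close> to \<open>\<tau>\<^sub>{\<^sub>p\<^sub>.\<^sub>.\<^sub>q\<^sub>} w\<^sub>p\<^sub>,\<^sub>q\<close> in the semidirect product of \<open>S\<^sub>n\<close> with the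
  right-angled Coxeter group on the subsets of \<open>{1..n}\<close>, where \<open>\<tau>\<^sub>I\<close> and \<open>\<tau>\<^sub>J\<close> commute iff \<open>I\<close> and \<open>J\<close>
  are disjoint or nested, and \<open>w\<^sub>p\<^sub>,\<^sub>q\<close> reverses \<open>{p..q}\<close>. Compose it with \<open>\<kappa>\<close> and kill the central
  letter \<open>\<tau>\<^sub>{\<^sub>1\<^sub>.\<^sub>.\<^sub>n\<^sub>}\<close>: each letter \<open>\<sigma>\<^sub>i\<close> or \<open>\<zeta>\<close>, \<open>\<zeta>\<^sup>-\<^sup>1\<close> of a twin word then contributes exactly one
  letter \<open>\<tau>\<^sub>I\<close>, where \<open>I\<close> is the pair of labels exchanged, or the complement of the label passing
  through infinity. If the twin word is in the kernel, then its nonempty image word is trivial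
  in a right-angled Coxeter group, so it contains \<open>\<tau>\<^sub>I \<dots> \<tau>\<^sub>I\<close> with everything in between commuting
  with \<open>\<tau>\<^sub>I\<close>. The relations of the twin group allow the corresponding cancellation in the twin word,
  and induction on the length finishes the proof.
\<close>

section \<open>Right-angled Coxeter groups\<close>

locale commutation =
  fixes C :: "'a \<Rightarrow> 'a \<Rightarrow> bool"
  assumes C_sym: "C x y \<Longrightarrow> C y x"
begin

text \<open>Equality in the Cartier-Foata trace monoid: letters may commute but do not cancel.
  Cancellation is left to \<open>push\<close>.\<close>

inductive trace_eq :: "'a list \<Rightarrow> 'a list \<Rightarrow> bool" where
  refl: "trace_eq w w"
| sym: "trace_eq u v \<Longrightarrow> trace_eq v u"
| trans: "trace_eq u v \<Longrightarrow> trace_eq v w \<Longrightarrow> trace_eq u w"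
| Cons: "trace_eq u v \<Longrightarrow> trace_eq (x # u) (x # v)"
| swap: "C x y \<Longrightarrow> trace_eq (x # y # w) (y # x # w)"

declare trace_eq.trans [trans]

text \<open>Equality is tested before \<open>C x y\<close> because \<open>C\<close> may be
  reflexive, as \<open>disjoint_or_nested\<close> is.\<close>

primrec pull :: "'a \<Rightarrow> 'a list \<Rightarrow> 'a list option" where
  "pull x [] = None"
| "pull x (y # w) =
    (if x = y then Some w else if C x y then map_option ((#) y) (pull x w) else None)"

text \<open>Left multiplication by the involution \<open>x\<close> on reduced words. This is van der
  Waerden's device: letting the group act on normal forms shows that distinct normal forms are
  distinct elements.\<close>

definition push :: "'a \<Rightarrow> 'a list \<Rightarrow> 'a list" where
  "push x w = (case pull x w of None \<Rightarrow> x # w | Some w' \<Rightarrow> w')"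

primrec reduced :: "'a list \<Rightarrow> bool" where
  "reduced [] \<longleftrightarrow> True"
| "reduced (x # w) \<longleftrightarrow> pull x w = None \<and> reduced w"

lemma trace_eq_length: "trace_eq u v \<Longrightarrow> length u = length v"
  by (induction rule: trace_eq.induct) auto

lemma pull_trace_eq: "pull x w = Some w' \<Longrightarrow> trace_eq w (x # w')"
proof (induction w arbitrary: w')
  case (Cons y w)
  show ?case
  proof (cases "x = y")
    case False
    with Cons.prems obtain v where v: "C x y" "pull x w = Some v" "w' = y # v"
      by (auto split: if_splits)
    have "trace_eq (y # w) (y # x # v)" by (rule trace_eq.Cons[OF Cons.IH[OF v(2)]])
    also have "trace_eq (y # x # v) (x # y # v)"
      by (rule trace_eq.swap[OF C_sym[OF v(1)]])
    finally show ?thesis using v by simp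
  qed (use Cons.prems in \<open>auto intro: trace_eq.refl\<close>)
qed simp

text \<open>Two swapped letters other than \<open>x\<close> must both commute with \<open>x\<close>
  in either order; if one of them is \<open>x\<close>, the swap itself provides the
  commutation.\<close>

lemma pull_cong: "trace_eq u v \<Longrightarrow> rel_option trace_eq (pull x u) (pull x v)"
proof (induction rule: trace_eq.induct)
  case (refl w)
  show ?case by (cases "pull x w") (auto intro: trace_eq.refl)
next
  case (sym u v)
  then show ?case by (cases "pull x u"; cases "pull x v") (auto intro: trace_eq.sym)
next
  case (trans u v w)
  then show ?case
    by (cases "pull x u"; cases "pull x v"; cases "pull x w") (auto intro: trace_eq.trans)
next
  case (Cons u v y)
  then show ?case
    by (cases "pull x u"; cases "pull x v") (auto intro: trace_eq.intros)
next
  case (swap y z w)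
  then show ?case
    by (cases "pull x w") (auto intro: trace_eq.intros dest: C_sym)
qed

lemma push_cong: "trace_eq u v \<Longrightarrow> trace_eq (push x u) (push x v)"
  using pull_cong[of u v x]
  by (cases "pull x u"; cases "pull x v") (auto simp: push_def intro: trace_eq.Cons)

text \<open>Taking out \<open>x\<close> neither removes \<open>y\<close> nor unblocks it, since the
  two letters are distinct and commute.\<close>

lemma pull_pull:
  assumes "C x y" "x \<noteq> y" "pull x w = Some w'"
  shows "pull y w' = Option.bind (pull y w) (pull x)"
    and "pull y w = None \<longleftrightarrow> pull y w' = None"
proof -
  have "pull y w' = Option.bind (pull y w) (pull x) \<and>
      (pull y w = None \<longleftrightarrow> pull y w' = None)"
    using assms(3)
  proof (induction w arbitrary: w')
    case (Cons z w)
    show ?case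
    proof (cases "x = z")
      case True
      with Cons.prems assms(1,2) C_sym show ?thesis by (cases "pull y w") auto
    next
      case False
      with Cons.prems obtain v where v: "C x z" "pull x w = Some v" "w' = z # v"
        by (auto split: if_splits)
      then show ?thesis
        using Cons.IH[OF v(2)] False by (cases "pull y w"; cases "pull y v") auto
    qed
  qed simp
  then show "pull y w' = Option.bind (pull y w) (pull x)"
    and "pull y w = None \<longleftrightarrow> pull y w' = None" by auto
qed

text \<open>A second \<open>x\<close> that could be pulled would cancel against the first inside
  \<open>w\<close>. Removing \<open>x\<close> creates no new cancellation, since the letters before
  it commute with it and differ from it, so \<open>pull_pull\<close> applies.\<close>

lemma pull_reduced:
  assumes "reduced w" "pull x w = Some w'"
  shows "pull x w' = None" and "reduced w'"
proof -
  have "pull x w' = None \<and> reduced w'"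
    using assms
  proof (induction w arbitrary: w')
    case (Cons y w)
    show ?case
    proof (cases "x = y")
      case False
      with Cons.prems obtain v where v: "C x y" "pull x w = Some v" "w' = y # v"
        by (auto split: if_splits)
      then show ?thesis
        using Cons.IH[OF _ v(2)] Cons.prems(1) False pull_pull(2)[OF v(1) False v(2)] by auto
    qed (use Cons.prems in auto)
  qed simp
  then show "pull x w' = None" and "reduced w'" by auto
qed

section \<open>The action on reduced words\<close>

lemma reduced_push: "reduced w \<Longrightarrow> reduced (push x w)"
  using pull_reduced(2)[of w x] by (auto simp: push_def split: option.split)

lemma reduced_foldr_push: "reduced w \<Longrightarrow> reduced (foldr push u w)"
  by (induction u) (auto simp: reduced_push)

lemma foldr_push_cong: "trace_eq v w \<Longrightarrow> trace_eq (foldr push u v) (foldr push u w)"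
  by (induction u) (auto simp: push_cong)

text \<open>Reducedness matters: otherwise each of the two pushes could delete an \<open>x\<close>
  from \<open>w\<close>.\<close>

lemma push_push:
  assumes "reduced w"
  shows "trace_eq (push x (push x w)) w"
proof (cases "pull x w")
  case None
  then show ?thesis by (simp add: push_def trace_eq.refl)
next
  case (Some w')
  then show ?thesis
    using pull_reduced(1)[OF assms Some] pull_trace_eq[OF Some]
    by (auto simp: push_def intro: trace_eq.sym)
qed

lemma push_commute:
  assumes "C x y"
  shows "trace_eq (push x (push y w)) (push y (push x w))"
proof (cases "x = y")
  case False
  note C = assms C_sym[OF assms]
  show ?thesis
  proof (cases "pull x w")
    case None
    show ?thesis
    proof (cases "pull y w")
      case None
      then show ?thesis
        using \<open>pull x w = None\<close> False C by (simp add: push_def trace_eq.swap)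
    next
      case (Some v)
      then show ?thesis
        using None False C pull_pull(2)[OF C(2) _ Some] by (simp add: push_def trace_eq.refl)
    qed
  next
    case (Some v)
    show ?thesis
    proof (cases "pull y w")
      case None
      then show ?thesis
        using Some False C pull_pull(2)[OF C(1) False Some]
        by (simp add: push_def trace_eq.refl)
    next
      case u: (Some u)
      then show ?thesis
        using Some False C pull_pull[OF C(1) False Some]
        by (auto simp add: push_def trace_eq.refl)
    qed
  qed
qed (simp add: trace_eq.refl)

text \<open>Hence a nonempty reduced word moves the empty word, so it does not act
  trivially.\<close>

lemma foldr_push_reduced: "reduced w \<Longrightarrow> foldr push w [] = w"
  by (induction w) (auto simp: push_def)

end


section \<open>The subsets reversed by a word of the cactus group\<close>

definition disjoint_or_nested :: "'a set \<Rightarrow> 'a set \<Rightarrow> bool" where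
  "disjoint_or_nested I J \<longleftrightarrow> I \<inter> J = {} \<or> I \<subseteq> J \<or> J \<subseteq> I"

interpretation commutation disjoint_or_nested
  by standard (auto simp: disjoint_or_nested_def)

lemma disjoint_or_nested_image:
  "inj f \<Longrightarrow> disjoint_or_nested (f ` I) (f ` J) \<longleftrightarrow> disjoint_or_nested I J"
  by (simp add: disjoint_or_nested_def inj_image_subset_iff flip: image_Int)

section \<open>Reversals of intervals\<close>

definition interval_rev :: "nat \<Rightarrow> nat \<Rightarrow> nat \<Rightarrow> nat" where
  "interval_rev p q i = (if p \<le> i \<and> i \<le> q then p + q - i else i)"

lemma interval_rev_idem [simp]: "interval_rev p q (interval_rev p q i) = i"
  by (auto simp: interval_rev_def)

lemma inj_interval_rev [simp]: "inj (interval_rev p q)"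
  by (rule inj_on_inverseI[where g = "interval_rev p q"])
    simp

lemma interval_rev_image:
  assumes "{m..r} \<subseteq> {p..q}" "m \<le> r"
  shows "interval_rev p q ` {m..r} = {p + q - r..p + q - m}"
proof -
  have "x \<in> interval_rev p q ` {m..r}" if "x \<in> {p + q - r..p + q - m}" for x
    using that assms by (intro image_eqI[of _ _ "p + q - x"]) (auto simp: interval_rev_def)
  moreover have "interval_rev p q ` {m..r} \<subseteq> {p + q - r..p + q - m}"
    using assms by (auto simp: interval_rev_def)
  ultimately show ?thesis by blast
qed

lemma comp_image_eqI: "g ` A = B \<Longrightarrow> (f \<circ> g) ` A = f ` B"
  by (metis image_comp)

lemma interval_rev_image_disjoint:
  "{p..q} \<inter> A = {} \<Longrightarrow> interval_rev p q ` A = A"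
  by (force simp: interval_rev_def image_iff)

lemma interval_rev_image_super:
  assumes "{p..q} \<subseteq> A"
  shows "interval_rev p q ` A = A"
proof -
  have *: "interval_rev p q ` A \<subseteq> A" using assms by (intro image_subsetI) (auto simp: interval_rev_def intro!: subsetD[OF assms])
  have "A = interval_rev p q ` interval_rev p q ` A" by (simp add: image_comp)
  with * show ?thesis by blast
qed

lemma interval_rev_commute:
  assumes "{p..q} \<inter> {m..r} = {}"
  shows "interval_rev p q \<circ> interval_rev m r = interval_rev m r \<circ> interval_rev p q"
proof
  fix i
  \<comment> \<open>Used at \<open>i\<close> and at both reflections, since a reflected point stays
    in its own interval.\<close>
  have d: "\<not> (p \<le> j \<and> j \<le> q \<and> m \<le> j \<and> j \<le> r)" for j using assms by auto
  show "(interval_rev p q \<circ> interval_rev m r) i = (interval_rev m r \<circ> interval_rev p q) i"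
    using d[of i] d[of "p + q - i"] d[of "m + r - i"] by (auto simp: interval_rev_def)
qed

lemma interval_rev_conj:
  assumes "{m..r} \<subseteq> {p..q}" "m \<le> r"
  shows "interval_rev p q \<circ> interval_rev m r =
    interval_rev (p + q - r) (p + q - m) \<circ> interval_rev p q"
proof -
  have "p \<le> m" "r \<le> q" using assms by auto
  with assms(2) show ?thesis by (intro ext) (auto simp: interval_rev_def)
qed

text \<open>
  The \<open>\<tau>\<close>-letters of the image of a word, with the permutations moved to the right end; \<open>\<pi>\<close> is
  the permutation accumulated before the word.
\<close>

fun cactus_sets :: "nat \<Rightarrow> (nat \<Rightarrow> nat) \<Rightarrow> (nat \<times> nat) word \<Rightarrow> nat set list" where
  "cactus_sets n \<pi> [] = []"
| "cactus_sets n \<pi> ((b, p, q) # w) =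
    (if (p, q) = (1, n) then [] else [\<pi> ` {p..q}]) @ cactus_sets n (\<pi> \<circ> interval_rev p q) w"

text \<open>Signs are ignored, here and in \<open>cactus_sets\<close>, because each generator and
  its formal inverse have the same image.\<close>

fun cactus_perm :: "(nat \<times> nat) word \<Rightarrow> nat \<Rightarrow> nat" where
  "cactus_perm [] = id"
| "cactus_perm ((b, p, q) # w) = interval_rev p q \<circ> cactus_perm w"

lemma inj_cactus_perm [simp]: "inj (cactus_perm w)"
  by (induction w rule: cactus_perm.induct)
    (simp_all only: cactus_perm.simps inj_compose inj_interval_rev inj_on_id)

lemma cactus_perm_append: "cactus_perm (u @ v) = cactus_perm u \<circ> cactus_perm v"
  by (induction u rule: cactus_perm.induct) (auto simp: comp_assoc)

lemma cactus_sets_append: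
  "cactus_sets n \<pi> (u @ v) = cactus_sets n \<pi> u @ cactus_sets n (\<pi> \<circ> cactus_perm u) v"
  by (induction u arbitrary: \<pi> rule: cactus_perm.induct) (simp_all add: comp_assoc)

text \<open>A repeated generator thus contributes the same set twice, and \<open>push_push\<close>
  cancels the pair.\<close>

lemma interval_rev_image_self: "(\<lambda>i. \<pi> (interval_rev p q i)) ` {p..q} = \<pi> ` {p..q}"
  using comp_image_eqI[OF interval_rev_image_super[OF subset_refl], of \<pi> p q] by (simp add: comp_def)

text \<open>The general \<open>\<pi>\<close> and \<open>w\<close> serve the append case: the second
  factor is read after the permutation of the first, and the first acts on the result of the second.
  Cancellation needs \<open>w\<close> reduced.\<close>

lemma cactus_sets_word_eq:
  assumes "word_eq (cactus_gens n) (cactus_rels n) u v"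
  shows "cactus_perm u = cactus_perm v \<and> (\<forall>\<pi> w. inj \<pi> \<longrightarrow> reduced w \<longrightarrow>
    trace_eq (foldr push (cactus_sets n \<pi> u) w) (foldr push (cactus_sets n \<pi> v) w))"
  using assms
proof (induction rule: word_eq.induct)
  case (refl w)
  then show ?case by (simp add: trace_eq.refl)
next
  case (sym u v)
  then show ?case by (auto intro: trace_eq.sym)
next
  case (trans u v w)
  then show ?case by (metis trace_eq.trans)
next
  case (append u v u' v')
  have "trace_eq (foldr push (cactus_sets n \<pi> (u @ u')) w) (foldr push (cactus_sets n \<pi> (v @ v')) w)"
    if "inj \<pi>" "reduced w" for \<pi> w
  proof -
    let ?x = "foldr push (cactus_sets n (\<pi> \<circ> cactus_perm u) u') w"
    let ?y = "foldr push (cactus_sets n (\<pi> \<circ> cactus_perm u) v') w"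
    have "trace_eq ?x ?y"
      using append.IH(2) that inj_compose[OF that(1) inj_cactus_perm[of u]] by simp
    then have "trace_eq (foldr push (cactus_sets n \<pi> u) ?x) (foldr push (cactus_sets n \<pi> u) ?y)"
      by (rule foldr_push_cong)
    also
    have "trace_eq (foldr push (cactus_sets n \<pi> u) ?y) (foldr push (cactus_sets n \<pi> v) ?y)"
      using append.IH(1) that by (auto intro: reduced_foldr_push)
    finally show ?thesis
      using append.IH(1) by (simp add: cactus_sets_append)
  qed
  then show ?case using append.IH by (simp add: cactus_perm_append)
next
  case (cancel s b)
  obtain p q where s: "s = (p, q)" by (cases s)
  show ?case
    by (auto simp: s interval_rev_image_self comp_def push_push trace_eq.refl)
next
  case (rel u v)
  then consider
    (sq) p q where "(p, q) \<in> cactus_gens n" "u = gens_word [(p, q), (p, q)]" "v = []"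
  | (disj) p q m r where "(p, q) \<in> cactus_gens n" "(m, r) \<in> cactus_gens n" "{p..q} \<inter> {m..r} = {}"
      "u = gens_word [(p, q), (m, r)]" "v = gens_word [(m, r), (p, q)]"
  | (nest) p q m r where "(p, q) \<in> cactus_gens n" "(m, r) \<in> cactus_gens n" "{m..r} \<subseteq> {p..q}"
      "u = gens_word [(p, q), (m, r)]" "v = gens_word [(p + q - r, p + q - m), (p, q)]"
    unfolding cactus_rels_def by blast
  then show ?case
  proof cases
    case sq
    then show ?thesis
      by (auto simp: interval_rev_image_self comp_def push_push trace_eq.refl)
  next
    case disj
    have im: "(\<pi> \<circ> interval_rev p q) ` {m..r} = \<pi> ` {m..r}"
      "(\<pi> \<circ> interval_rev m r) ` {p..q} = \<pi> ` {p..q}" for \<pi> :: "nat \<Rightarrow> nat"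
      by (intro comp_image_eqI interval_rev_image_disjoint; use disj(3) in blast)+
    have "disjoint_or_nested {p..q} {m..r}" using disj(3) by (simp add: disjoint_or_nested_def)
    \<comment> \<open>An interval disjoint from that of another generator is not all of
      \<open>{1..n}\<close>, so neither letter is dropped.\<close>
    moreover have "(p, q) \<noteq> (1, n)" "(m, r) \<noteq> (1, n)"
      using disj(1-3) by (auto simp: cactus_gens_def)
    ultimately show ?thesis
      using interval_rev_commute[OF disj(3)] disj(4,5)
      by (auto simp: im[unfolded comp_def] comp_def disjoint_or_nested_image
          simp del: prod.inject intro!: push_commute trace_eq.refl)
  next
    case nest
    let ?m = "p + q - r" and ?r = "p + q - m"
    have lt: "p < q" "m < r" "1 \<le> p" "q \<le> n" "p \<le> m" "r \<le> q"
      using nest(1-3) by (auto simp: cactus_gens_def)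
    have sub: "{?m..?r} \<subseteq> {p..q}" using lt by auto
    have im: "(\<pi> \<circ> interval_rev p q) ` {m..r} = \<pi> ` {?m..?r}"
      "(\<pi> \<circ> interval_rev ?m ?r) ` {p..q} = \<pi> ` {p..q}" for \<pi> :: "nat \<Rightarrow> nat"
      by (intro comp_image_eqI interval_rev_image interval_rev_image_super nest(3) sub
          less_imp_le[OF lt(2)])+
    have C: "disjoint_or_nested {p..q} {?m..?r}" using sub by (simp add: disjoint_or_nested_def)
    have u: "cactus_sets n \<pi> u = (if (p, q) = (1, n) then [] else [\<pi> ` {p..q}]) @
        (if (m, r) = (1, n) then [] else [\<pi> ` {?m..?r}])"
      and v: "cactus_sets n \<pi> v = (if (?m, ?r) = (1, n) then [] else [\<pi> ` {?m..?r}]) @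
        (if (p, q) = (1, n) then [] else [\<pi> ` {p..q}])" for \<pi>
      by (simp_all only: nest(4,5) list.map cactus_sets.simps im append_Nil2)
    have perm: "cactus_perm u = cactus_perm v"
      by (simp only: nest(4,5) list.map cactus_perm.simps comp_id
          interval_rev_conj[OF nest(3) less_imp_le[OF lt(2)]])
    show ?thesis
    \<comment> \<open>If the outer interval is everything, its letter is dropped on both sides and
      what remains agrees. Otherwise no letter is dropped, and the two nested letters
      commute.\<close>
    proof (cases "(p, q) = (1, n)")
      case True
      then have "(?m, ?r) = (1, n) \<longleftrightarrow> (m, r) = (1, n)" using lt by auto
      then have "cactus_sets n \<pi> u = cactus_sets n \<pi> v" for \<pi>
        unfolding u v using True by simp
      with perm show ?thesis by (simp add: trace_eq.refl)
    next
      case False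
      then have "(m, r) \<noteq> (1, n)" "(?m, ?r) \<noteq> (1, n)" using lt by auto
      with False have "cactus_sets n \<pi> u = [\<pi> ` {p..q}, \<pi> ` {?m..?r}]"
        "cactus_sets n \<pi> v = [\<pi> ` {?m..?r}, \<pi> ` {p..q}]" for \<pi>
        unfolding u v by auto
      with perm C show ?thesis by (simp add: disjoint_or_nested_image push_commute)
    qed
  qed
qed


section \<open>Twin words\<close>

fun kappa_letter :: "nat \<Rightarrow> bool \<times> twin_gen \<Rightarrow> (nat \<times> nat) word" where
  "kappa_letter n (b, Sg i) = [(b, i, i + 1)]"
| "kappa_letter n (True, Zt) = [(True, 1, n), (True, 2, n)]"
| "kappa_letter n (False, Zt) = [(False, 2, n), (False, 1, n)]"

definition kappa_word :: "nat \<Rightarrow> twin_gen word \<Rightarrow> (nat \<times> nat) word" where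
  "kappa_word n u = concat (map (kappa_letter n) u)"

lemma kappa_word_words: "3 \<le> n \<Longrightarrow> u \<in> words (twin_gens n) \<Longrightarrow> kappa_word n u \<in> words (cactus_gens n)"
proof (induction u)
  case (Cons a u)
  then show ?case
    by (cases "(n, a)" rule: kappa_letter.cases)
      (auto simp: kappa_word_def cactus_gens_def twin_gens_def)
qed (simp add: kappa_word_def)

lemma inv_presented_gen:
  assumes R: "R \<subseteq> words S \<times> words S" and s: "s \<in> S"
  shows "inv\<^bsub>presented_group S R\<^esub> presented_gen S R s = word_rel S R `` {[(False, s)]}"
proof (rule group.inv_equality[OF group_presented_group[OF R]])
  have "word_eq S R [(False, s), (\<not> False, s)] []" by (rule word_eq.cancel[OF s])
  then show "word_rel S R `` {[(False, s)]} \<otimes>\<^bsub>presented_group S R\<^esub> presented_gen S R s =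
      \<one>\<^bsub>presented_group S R\<^esub>"
    using s by (simp add: presented_gen_def one_presented_group mult_presented_group[OF R]
        word_class_eq_iff[OF R])
qed (use s in \<open>auto simp: presented_gen_def carrier_presented_group\<close>)

text \<open>Lifts the homomorphism to representatives, so that the kernel can be studied on
  words.\<close>

lemma kappa_class:
  assumes n: "3 \<le> n" and u: "u \<in> words (twin_gens n)"
  shows "kappa n (word_rel (twin_gens n) (twin_rels n) `` {u}) =
    word_rel (cactus_gens n) (cactus_rels n) `` {kappa_word n u}"
proof -
  let ?S = "cactus_gens n" and ?R = "cactus_rels n"
  let ?J = "full_cactus_group n"
  interpret J: group ?J by (rule group_full_cactus_group)
  have mult: "word_rel ?S ?R `` {v} \<otimes>\<^bsub>?J\<^esub> word_rel ?S ?R `` {w} = word_rel ?S ?R `` {v @ w}"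
    if "v \<in> words ?S" "w \<in> words ?S" for v w
    unfolding full_cactus_group_def by (rule mult_presented_group[OF cactus_rels_words that])
  have inv: "inv\<^bsub>?J\<^esub> cactus n p q = word_rel ?S ?R `` {[(False, p, q)]}"
    if "(p, q) \<in> ?S" for p q
    unfolding full_cactus_group_def cactus_def by (rule inv_presented_gen[OF cactus_rels_words that])
  have gen: "cactus n p q = word_rel ?S ?R `` {[(True, p, q)]}" for p q
    by (simp add: cactus_def presented_gen_def)
  have 1: "(1, n) \<in> ?S" "(2, n) \<in> ?S" using n by (auto simp: cactus_gens_def)
  have letter: "(if b then kappa_gen n s else inv\<^bsub>?J\<^esub> kappa_gen n s) =
      word_rel ?S ?R `` {kappa_letter n (b, s)}" if "s \<in> twin_gens n" for b s
  proof (cases s)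
    case (Sg i)
    with that n have "(i, i + 1) \<in> ?S" by (auto simp: twin_gens_def cactus_gens_def)
    from inv[OF this] show ?thesis by (simp add: Sg gen)
  next
    case Zt
    show ?thesis
    proof (cases b)
      case True
      then show ?thesis using 1 by (simp add: Zt gen mult)
    next
      case False
      have "inv\<^bsub>?J\<^esub> kappa_gen n Zt = inv\<^bsub>?J\<^esub> cactus n 2 n \<otimes>\<^bsub>?J\<^esub> inv\<^bsub>?J\<^esub> cactus n 1 n"
        using 1 by (simp add: J.inv_mult_group cactus_closed)
      also have "\<dots> = word_rel ?S ?R `` {kappa_letter n (False, Zt)}"
        using 1 by (simp only: inv) (simp add: mult)
      finally show ?thesis using False Zt by simp
    qed
  qed
  have "word_val ?J (kappa_gen n) u = word_rel ?S ?R `` {kappa_word n u}"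
    using u
  proof (induction u)
    case Nil
    then show ?case by (simp add: kappa_word_def one_full_cactus_group)
  next
    case (Cons a u)
    obtain b s where a: "a = (b, s)" by (cases a)
    with Cons.prems have s: "s \<in> twin_gens n" "u \<in> words (twin_gens n)" by auto
    have "kappa_letter n (b, s) \<in> words ?S"
      using kappa_word_words[OF n, of "[(b, s)]"] s by (simp add: kappa_word_def)
    with Cons.IH[OF s(2)] letter[OF s(1)] kappa_word_words[OF n s(2)] show ?case
      by (simp add: a mult) (simp add: kappa_word_def)
  qed
  then show ?thesis
    unfolding kappa_def
    using induced_hom_class[OF group_full_cactus_group kappa_gen_closed[OF n] twin_rels_words
        kappa_gen_rels[OF n] u] by simp
qed

text \<open>For \<open>Zt\<close> the letter of \<open>s\<^sub>1\<^sub>,\<^sub>n\<close> is dropped.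
  In the positive case \<open>{2..n}\<close> is read after the full reversal and becomes
  \<open>{1..n - 1}\<close>; in the negative case it is read first.\<close>

fun letter_set :: "nat \<Rightarrow> bool \<times> twin_gen \<Rightarrow> nat set" where
  "letter_set n (b, Sg i) = {i..i + 1}"
| "letter_set n (True, Zt) = {1..n - 1}"
| "letter_set n (False, Zt) = {2..n}"

definition letter_perm :: "nat \<Rightarrow> bool \<times> twin_gen \<Rightarrow> nat \<Rightarrow> nat" where
  "letter_perm n a = cactus_perm (kappa_letter n a)"

definition twin_sets :: "nat \<Rightarrow> (nat \<Rightarrow> nat) \<Rightarrow> twin_gen word \<Rightarrow> nat set list" where
  "twin_sets n \<pi> u = cactus_sets n \<pi> (kappa_word n u)"

lemma twin_sets_Nil [simp]: "twin_sets n \<pi> [] = []"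
  by (simp add: twin_sets_def kappa_word_def)

lemma twin_sets_Cons:
  assumes "4 \<le> n"
  shows "twin_sets n \<pi> (a # u) = \<pi> ` letter_set n a # twin_sets n (\<pi> \<circ> letter_perm n a) u"
proof -
  have "interval_rev 1 n ` {2..n} = {1..n - 1}"
    using interval_rev_image[of 2 n 1 n] assms by simp
  then have "(\<pi> \<circ> interval_rev 1 n) ` {2..n} = \<pi> ` {1..n - 1}"
    by (simp only: flip: image_comp)
  then show ?thesis
    using assms by (cases "(n, a)" rule: letter_set.cases)
      (simp_all add: twin_sets_def kappa_word_def letter_perm_def comp_assoc)
qed

lemma inj_letter_perm: "inj (letter_perm n a)"
  by (simp add: letter_perm_def)

text \<open>The product of the two reversals is a cyclic rotation, which shifts by one every
  interval avoiding the strand that wraps around.\<close>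

lemma letter_perm_Zt_image:
  assumes "1 \<le> m" "m \<le> r" "r < n"
  shows "letter_perm n (True, Zt) ` {m + 1..r + 1} = {m..r}"
    and "letter_perm n (False, Zt) ` {m..r} = {m + 1..r + 1}"
proof -
  have "interval_rev 2 n ` {m + 1..r + 1} = {n + 1 - r..n + 1 - m}"
    by (subst interval_rev_image) (use assms in auto)
  moreover have "interval_rev 1 n ` {n + 1 - r..n + 1 - m} = {m..r}"
    by (subst interval_rev_image) (use assms in auto)
  ultimately show "letter_perm n (True, Zt) ` {m + 1..r + 1} = {m..r}"
    unfolding letter_perm_def kappa_letter.simps cactus_perm.simps comp_id
    by (simp only: flip: image_comp)
  have "interval_rev 1 n ` {m..r} = {n + 1 - r..n + 1 - m}"
    by (subst interval_rev_image) (use assms in auto)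
  moreover have "interval_rev 2 n ` {n + 1 - r..n + 1 - m} = {m + 1..r + 1}"
    by (subst interval_rev_image) (use assms in auto)
  ultimately show "letter_perm n (False, Zt) ` {m..r} = {m + 1..r + 1}"
    unfolding letter_perm_def kappa_letter.simps cactus_perm.simps comp_id
    by (simp only: flip: image_comp)
qed

section \<open>Rewriting twin words\<close>

lemma word_eq_context:
  assumes "word_eq S R u v" "p \<in> words S" "q \<in> words S"
  shows "word_eq S R (p @ u @ q) (p @ v @ q)"
  by (intro word_eq.append word_eq.refl assms)

definition twin_eq :: "nat \<Rightarrow> twin_gen word \<Rightarrow> twin_gen word \<Rightarrow> bool" where
  "twin_eq n = word_eq (twin_gens n) (twin_rels n)"

lemma twin_eq_trans [trans]: "twin_eq n u v \<Longrightarrow> twin_eq n v w \<Longrightarrow> twin_eq n u w"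
  unfolding twin_eq_def by (rule word_eq.trans)

lemma twin_eq_sym: "twin_eq n u v \<Longrightarrow> twin_eq n v u"
  unfolding twin_eq_def by (rule word_eq.sym)

lemma twin_eq_words: "twin_eq n u v \<Longrightarrow> u \<in> words (twin_gens n) \<and> v \<in> words (twin_gens n)"
  unfolding twin_eq_def by (rule word_eq_words[OF twin_rels_words])

lemma twin_eq_context:
  "twin_eq n u v \<Longrightarrow> p \<in> words (twin_gens n) \<Longrightarrow> q \<in> words (twin_gens n) \<Longrightarrow>
    twin_eq n (p @ u @ q) (p @ v @ q)"
  unfolding twin_eq_def by (rule word_eq_context)

lemma twin_eq_Cons:
  "twin_eq n u v \<Longrightarrow> s \<in> twin_gens n \<Longrightarrow> twin_eq n ((b, s) # u) ((b, s) # v)"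
  using twin_eq_context[of n u v "[(b, s)]" "[]"] by simp

lemma twin_eq_append_right:
  "twin_eq n u v \<Longrightarrow> w \<in> words (twin_gens n) \<Longrightarrow> twin_eq n (u @ w) (v @ w)"
  using twin_eq_context[of n u v "[]" w] by simp

lemma twin_eq_refl: "u \<in> words (twin_gens n) \<Longrightarrow> twin_eq n u u"
  unfolding twin_eq_def by (rule word_eq.refl)

lemma twin_eq_cancel: "s \<in> twin_gens n \<Longrightarrow> twin_eq n [(b, s), (\<not> b, s)] []"
  unfolding twin_eq_def by (rule word_eq.cancel)

lemma Zt_in_gens [simp]: "Zt \<in> twin_gens n"
  by (simp add: twin_gens_def)

lemma Sg_in_gens [simp]: "Sg i \<in> twin_gens n \<longleftrightarrow> 1 \<le> i \<and> i \<le> n - 1"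
  by (auto simp: twin_gens_def)

text \<open>Both signs agree because the generator is an involution. The sets do not record the sign
  of a \<open>Sg\<close> letter, so cancellation has to work for either.\<close>

lemma twin_eq_Sg_sign:
  assumes "Sg i \<in> twin_gens n"
  shows "twin_eq n [(b, Sg i)] [(b', Sg i)]"
proof -
  have "twin_eq n [(True, Sg i), (True, Sg i)] []"
    using assms unfolding twin_eq_def by (intro word_eq.rel) (force simp: twin_rels_def)
  from twin_eq_context[OF this, of "[(False, Sg i)]" "[]"]
  have "twin_eq n [(False, Sg i), (True, Sg i), (True, Sg i)] [(False, Sg i)]"
    using assms by simp
  moreover have "twin_eq n [(False, Sg i), (True, Sg i), (True, Sg i)] [(True, Sg i)]"
    using twin_eq_context[OF twin_eq_cancel[OF assms, of False], of "[]" "[(True, Sg i)]"] assms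
    by simp
  ultimately have *: "twin_eq n [(False, Sg i)] [(True, Sg i)]"
    by (meson twin_eq_sym twin_eq_trans)
  show ?thesis
    using * twin_eq_sym[OF *] assms by (cases b; cases b') (auto intro: twin_eq_refl)
qed

lemma twin_eq_Sg_resign:
  assumes "twin_eq n (p @ (b, Sg i) # q) w" "Sg i \<in> twin_gens n"
  shows "twin_eq n (p @ (b', Sg i) # q) w"
proof -
  have "p \<in> words (twin_gens n)" "q \<in> words (twin_gens n)"
    using twin_eq_words[OF assms(1)] by auto
  from twin_eq_context[OF twin_eq_Sg_sign[OF assms(2), of b' b] this] assms(1) show ?thesis
    by (auto intro: twin_eq_trans)
qed

lemma twin_eq_Sg_commute:
  assumes "Sg i \<in> twin_gens n" "Sg j \<in> twin_gens n" "\<bar>int i - int j\<bar> > 1"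
  shows "twin_eq n [(b, Sg i), (b', Sg j)] [(b', Sg j), (b, Sg i)]"
proof -
  have "twin_eq n [(True, Sg i), (True, Sg j)] [(True, Sg j), (True, Sg i)]"
    using assms unfolding twin_eq_def by (intro word_eq.rel) (force simp: twin_rels_def)
  then have "twin_eq n [(b, Sg i), (b', Sg j)] [(True, Sg j), (True, Sg i)]"
    using twin_eq_Sg_resign[of n "[]" True i "[(True, Sg j)]" _ b]
      twin_eq_Sg_resign[of n "[(b, Sg i)]" True j "[]" _ b'] assms by simp
  then have "twin_eq n [(True, Sg j), (True, Sg i)] [(b, Sg i), (b', Sg j)]"
    by (rule twin_eq_sym)
  then have "twin_eq n [(b', Sg j), (b, Sg i)] [(b, Sg i), (b', Sg j)]"
    using twin_eq_Sg_resign[of n "[]" True j "[(True, Sg i)]" _ b']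
      twin_eq_Sg_resign[of n "[(b', Sg j)]" True i "[]" _ b] assms by simp
  then show ?thesis by (rule twin_eq_sym)
qed

text \<open>The second rule is the first multiplied by the inverse of \<open>Zt\<close> on both
  sides.\<close>

lemma twin_eq_Zt_Sg:
  assumes "1 \<le> i" "i + 1 \<le> n - 1"
  shows "twin_eq n [(True, Zt), (b, Sg (i + 1))] [(b, Sg i), (True, Zt)]"
    and "twin_eq n [(False, Zt), (b, Sg i)] [(b, Sg (i + 1)), (False, Zt)]"
proof -
  have g: "Sg i \<in> twin_gens n" "Sg (i + 1) \<in> twin_gens n" using assms by auto
  have "twin_eq n [(True, Sg i), (True, Zt)] [(True, Zt), (True, Sg (i + 1))]"
    using assms unfolding twin_eq_def by (intro word_eq.rel) (force simp: twin_rels_def)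
  then have "twin_eq n [(b, Sg i), (True, Zt)] [(True, Zt), (True, Sg (i + 1))]"
    using twin_eq_Sg_resign[of n "[]" True i "[(True, Zt)]" _ b] g by simp
  from twin_eq_sym[OF this]
  show *: "twin_eq n [(True, Zt), (b, Sg (i + 1))] [(b, Sg i), (True, Zt)]"
    using twin_eq_Sg_resign[of n "[(True, Zt)]" True "i + 1" "[]" _ b] g by simp
  have "twin_eq n [(False, Zt), (b, Sg i)] [(False, Zt), (b, Sg i), (True, Zt), (False, Zt)]"
    using twin_eq_context[OF twin_eq_sym[OF twin_eq_cancel[OF Zt_in_gens, of n True]],
        of "[(False, Zt), (b, Sg i)]" "[]"] g by simp
  also have "twin_eq n \<dots> [(False, Zt), (True, Zt), (b, Sg (i + 1)), (False, Zt)]"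
    using twin_eq_context[OF twin_eq_sym[OF *], of "[(False, Zt)]" "[(False, Zt)]"] by simp
  also have "twin_eq n \<dots> [(b, Sg (i + 1)), (False, Zt)]"
    using twin_eq_context[OF twin_eq_cancel[OF Zt_in_gens, of n False],
        of "[]" "[(b, Sg (i + 1)), (False, Zt)]"] g by simp
  finally show "twin_eq n [(False, Zt), (b, Sg i)] [(b, Sg (i + 1)), (False, Zt)]" .
qed

lemma twin_eq_move_front:
  assumes "twin_eq n u (a # u')" "twin_eq n [b, a] [a', b']"
  shows "twin_eq n (b # u) (a' # b' # u')"
proof -
  obtain c s where b: "b = (c, s)" by (cases b)
  have w: "s \<in> twin_gens n" "u' \<in> words (twin_gens n)"
    using twin_eq_words[OF assms(1)] twin_eq_words[OF assms(2)] by (cases a; auto simp: b)+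
  have "twin_eq n (b # u) (b # a # u')"
    unfolding b by (rule twin_eq_Cons[OF assms(1) w(1)])
  also have "twin_eq n \<dots> (a' # b' # u')"
    using twin_eq_append_right[OF assms(2) w(2)] by simp
  finally show ?thesis .
qed

section \<open>Cancelling letters in twin words\<close>

lemma card_letter_set:
  assumes "4 \<le> n" "s \<in> twin_gens n"
  shows "card (letter_set n (b, s)) = (if s = Zt then n - 1 else 2)"
  using assms by (cases "(n, b, s)" rule: letter_set.cases) auto

text \<open>
  While the letters following \<open>a\<close> have sets disjoint from or nested with that of \<open>a\<close>, the
  strands \<open>a\<close> acts on stay neighbours (for \<open>\<sigma>\<^sub>i\<close>), or the strand that went through infinity stays
  extreme (for \<open>\<zeta>\<close>); so the next letter with the same set can be moved back to the front.
  For \<open>n = 3\<close> this fails, since then the sets of \<open>\<sigma>\<^sub>i\<close> and \<open>\<zeta>\<close> have the same size.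
\<close>

lemma pull_twin_sets:
  assumes n: "4 \<le> n" and inj: "inj \<pi>" and u: "u \<in> words (twin_gens n)"
    and a: "snd a \<in> twin_gens n"
    and pull: "pull (\<pi> ` letter_set n a) (twin_sets n \<pi> u) = Some L"
  shows "\<exists>u'. twin_eq n u (a # u') \<and> length u' < length u"
  using inj u a pull
\<comment> \<open>The letter \<open>a\<close> must vary: its index shifts when it passes
  \<open>Zt\<close>, while its set of labels stays the same.\<close>
proof (induction u arbitrary: \<pi> a L)
  case (Cons d u)
  obtain c t where d: "d = (c, t)" by (cases d)
  obtain b s where a: "a = (b, s)" by (cases a)
  have t: "t \<in> twin_gens n" and u: "u \<in> words (twin_gens n)" and s: "s \<in> twin_gens n"
    using Cons.prems(2,3) by (auto simp: d a)
  let ?A = "letter_set n a" and ?D = "letter_set n d"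
  let ?p = "\<pi> \<circ> letter_perm n d"
  have inj: "inj ?p" using Cons.prems(1) inj_letter_perm by (rule inj_compose)
  show ?case
  proof (cases "?A = ?D")
    case True
    have "card ?A = card ?D" using True by simp
    then have "s = Zt \<longleftrightarrow> t = Zt"
      using card_letter_set[OF n s, of b] card_letter_set[OF n t, of c] n
      by (auto simp: a d split: if_splits)
    \<comment> \<open>Since \<open>{1..n - 1}\<close> and \<open>{2..n}\<close> differ, two
      \<open>Zt\<close> letters with equal sets have equal signs; two \<open>Sg\<close> letters may
      still differ in sign.\<close>
    then consider "a = d" | i where "s = Sg i" "t = Sg i"
      using True n s t by (cases s; cases t; cases b; cases c) (auto simp: a d Icc_eq_Icc)
    then have "twin_eq n (d # u) (a # u)"
    proof cases
      case 1
      then show ?thesis using Cons.prems(2) by (auto intro: twin_eq_refl)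
    next
      case 2
      then show ?thesis
        using twin_eq_append_right[OF twin_eq_Sg_sign[OF s[unfolded 2(1)], of c b] u]
        by (simp add: a d)
    qed
    then show ?thesis by auto
  next
    case False
    with Cons.prems(1,4) obtain L' where dn: "disjoint_or_nested ?A ?D"
      and L': "pull (\<pi> ` ?A) (twin_sets n ?p u) = Some L'"
      by (auto simp: twin_sets_Cons[OF n] inj_image_eq_iff disjoint_or_nested_image
          split: if_splits)
    \<comment> \<open>Here \<open>a'\<close> is the letter which, read after \<open>d\<close>, has
      the labels that \<open>a\<close> has before \<open>d\<close>.\<close>
    have move: ?thesis
      if "snd a' \<in> twin_gens n" "letter_perm n d ` letter_set n a' = ?A" "twin_eq n [d, a'] [a, d']"
      for a' d'
    proof -
      have "pull (?p ` letter_set n a') (twin_sets n ?p u) = Some L'"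
        using L' comp_image_eqI[OF that(2), of \<pi>] by simp
      from Cons.IH[OF inj u that(1) this]
      obtain u' where "twin_eq n u (a' # u')" "length u' < length u" by blast
      with twin_eq_move_front[OF this(1) that(3)] show ?thesis
        by (intro exI[of _ "d' # u'"]) simp
    qed
    show ?thesis
    proof (cases t)
      case t': (Sg j)
      have j: "1 \<le> j" "j \<le> n - 1" using t by (simp_all add: t')
      have perm: "letter_perm n d = interval_rev j (j + 1)"
        by (simp add: letter_perm_def d t')
      show ?thesis
      proof (cases s)
        case s': (Sg i)
        have i: "1 \<le> i" "i \<le> n - 1" using s by (simp_all add: s')
        \<comment> \<open>Two distinct pairs cannot be nested, so they are disjoint.\<close>
        have disj: "{j..j + 1} \<inter> {i..i + 1} = {}" and far: "\<bar>int j - int i\<bar> > 1"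
          using dn False by (auto simp: a d s' t' disjoint_or_nested_def)
        show ?thesis
        proof (rule move[of a d])
          show "letter_perm n d ` ?A = ?A"
            unfolding perm using interval_rev_image_disjoint[OF disj] by (simp add: a s')
          show "twin_eq n [d, a] [a, d]"
            using twin_eq_Sg_commute[of j n i c b] s t far by (simp add: a d s' t')
        qed (simp add: a s)
      next
        case s': Zt
        show ?thesis
        proof (cases b)
          case True
          then have A: "a = (True, Zt)" "?A = {1..n - 1}" by (simp_all add: a s')
          \<comment> \<open>For \<open>j = n - 1\<close> the pair would contain the strand at the
            end, and its set would cross \<open>{1..n - 1}\<close>. The other end and the case of
            \<open>d = Zt\<close> are excluded in the same way.\<close>
          have "j + 1 \<le> n - 1"
          proof (rule ccontr)
            assume "\<not> ?thesis"
            then have "n - 1 \<in> ?A \<inter> ?D" "n \<in> ?D - ?A" "1 \<in> ?A - ?D"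
              using j n by (auto simp: A d t')
            with dn show False by (auto simp: disjoint_or_nested_def)
          qed
          moreover from this have "letter_perm n d ` ?A = ?A"
            unfolding perm by (intro interval_rev_image_super) (use j A in auto)
          ultimately show ?thesis
            using j s twin_eq_sym[OF twin_eq_Zt_Sg(1)[of j n c]]
            by (intro move[of a "(c, Sg (j + 1))"]) (simp_all add: A d t')
        next
          case False
          then have A: "a = (False, Zt)" "?A = {2..n}" by (simp_all add: a s')
          have "2 \<le> j"
          proof (rule ccontr)
            assume "\<not> ?thesis"
            then have "2 \<in> ?A \<inter> ?D" "1 \<in> ?D - ?A" "n \<in> ?A - ?D"
              using j n by (auto simp: A d t')
            with dn show False by (auto simp: disjoint_or_nested_def)
          qed
          moreover from this have "letter_perm n d ` ?A = ?A"
            unfolding perm by (intro interval_rev_image_super) (use j A in auto)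
          ultimately show ?thesis
            using j s twin_eq_sym[OF twin_eq_Zt_Sg(2)[of "j - 1" n c]]
            by (intro move[of a "(c, Sg (j - 1))"]) (simp_all add: A d t')
        qed
      qed
    next
      case t': Zt
      show ?thesis
      proof (cases s)
        case s': (Sg i)
        have i: "1 \<le> i" "i \<le> n - 1" using s by (simp_all add: s')
        show ?thesis
        proof (cases c)
          case True
          then have D: "d = (True, Zt)" "?D = {1..n - 1}" by (simp_all add: d t')
          have "i + 1 \<le> n - 1"
          proof (rule ccontr)
            assume "\<not> ?thesis"
            then have "n - 1 \<in> ?A \<inter> ?D" "n \<in> ?A - ?D" "1 \<in> ?D - ?A"
              using i n by (auto simp: D a s')
            with dn show False by (auto simp: disjoint_or_nested_def)
          qed
          \<comment> \<open>Past \<open>Zt\<close> the two strands sit one position higher, so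
            \<open>Sg (i + 1)\<close> is sought in the rest.\<close>
          then show ?thesis
            using i letter_perm_Zt_image(1)[of i "i + 1" n] twin_eq_Zt_Sg(1)[of i n b]
            by (intro move[of "(b, Sg (i + 1))" d]) (auto simp: D a s')
        next
          case False
          then have D: "d = (False, Zt)" "?D = {2..n}" by (simp_all add: d t')
          have "2 \<le> i"
          proof (rule ccontr)
            assume "\<not> ?thesis"
            then have "2 \<in> ?A \<inter> ?D" "1 \<in> ?A - ?D" "n \<in> ?D - ?A"
              using i n by (auto simp: D a s')
            with dn show False by (auto simp: disjoint_or_nested_def)
          qed
          then show ?thesis
            using i letter_perm_Zt_image(2)[of "i - 1" i n] twin_eq_Zt_Sg(2)[of "i - 1" n b]
            by (intro move[of "(b, Sg (i - 1))" d]) (auto simp: D a s')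
        qed
      next
        case s': Zt
        \<comment> \<open>Opposite passages through infinity have crossing sets, so this case is
          contradictory.\<close>
        have "{1..n - 1} \<noteq> {2..n}" using n by (auto simp: Icc_eq_Icc)
        then have "{?A, ?D} = {{1..n - 1}, {2..n}}"
          using False by (cases b; cases c) (auto simp: a d s' t')
        moreover have "1 \<in> {1..n - 1} - {2..n}" "n \<in> {2..n} - {1..n - 1}"
            "2 \<in> {1..n - 1} \<inter> {2..n}"
          using n by auto
        ultimately have "\<not> disjoint_or_nested ?A ?D"
          by (auto simp: disjoint_or_nested_def doubleton_eq_iff)
        with dn show ?thesis by blast
      qed
    qed
  qed
qed simp

definition letter_inv :: "bool \<times> 'a \<Rightarrow> bool \<times> 'a" where
  "letter_inv a = (\<not> fst a, snd a)"

text \<open>Read right after \<open>a\<close>, the inverse letter has the labels of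
  \<open>a\<close>; it is therefore the letter to bring forward and cancel.\<close>

lemma letter_perm_inv_image:
  assumes "4 \<le> n"
  shows "letter_perm n a ` letter_set n (letter_inv a) = letter_set n a"
proof (cases "(n, a)" rule: letter_set.cases)
  case (1 n b i)
  then show ?thesis
    by (simp add: letter_inv_def letter_perm_def interval_rev_image_super)
next
  case (2 n')
  then show ?thesis
    using letter_perm_Zt_image(1)[of 1 "n - 1" n] assms by (simp add: letter_inv_def numeral_2_eq_2)
next
  case (3 n')
  then show ?thesis
    using letter_perm_Zt_image(2)[of 1 "n - 1" n] assms by (simp add: letter_inv_def numeral_2_eq_2)
qed

lemma shorten_twin_word:
  assumes n: "4 \<le> n" and "inj \<pi>" "u \<in> words (twin_gens n)" "\<not> reduced (twin_sets n \<pi> u)"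
  shows "\<exists>u'. twin_eq n u u' \<and> length u' < length u"
  using assms(2-)
proof (induction u arbitrary: \<pi>)
  case (Cons a u)
  obtain b s where a: "a = (b, s)" by (cases a)
  have s: "s \<in> twin_gens n" and u: "u \<in> words (twin_gens n)" using Cons.prems(2) by (auto simp: a)
  let ?p = "\<pi> \<circ> letter_perm n a"
  have inj: "inj ?p" using Cons.prems(1) inj_letter_perm by (rule inj_compose)
  show ?case
  \<comment> \<open>If the tail is reduced, the failure comes from the first letter; otherwise the
    tail itself is shortened.\<close>
  proof (cases "reduced (twin_sets n ?p u)")
    case True
    with Cons.prems(3) obtain L where "pull (\<pi> ` letter_set n a) (twin_sets n ?p u) = Some L"
      by (auto simp: twin_sets_Cons[OF n])
    then have "pull (?p ` letter_set n (letter_inv a)) (twin_sets n ?p u) = Some L"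
      using comp_image_eqI[OF letter_perm_inv_image[OF n], of \<pi> a] by simp
    from pull_twin_sets[OF n inj u _ this] s
    obtain u' where u': "twin_eq n u (letter_inv a # u')" "length u' < length u"
      by (auto simp: letter_inv_def a)
    have "twin_eq n (a # u) (a # letter_inv a # u')"
      unfolding a by (rule twin_eq_Cons[OF u'(1)[unfolded a] s])
    also have "twin_eq n \<dots> u'"
      using twin_eq_append_right[OF twin_eq_cancel[OF s, of b], of u'] twin_eq_words[OF u'(1)]
      by (simp add: a letter_inv_def)
    finally show ?thesis using u'(2) by auto
  next
    case False
    from Cons.IH[OF inj u False] obtain u' where "twin_eq n u u'" "length u' < length u" by blast
    with twin_eq_Cons[OF this(1) s, of b] show ?thesis
      by (intro exI[of _ "a # u'"]) (simp add: a)
  qed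
qed simp

lemma kappa_word_eq_Nil:
  assumes n: "4 \<le> n" and "u \<in> words (twin_gens n)"
    and "word_eq (cactus_gens n) (cactus_rels n) (kappa_word n u) []"
  shows "twin_eq n u []"
  using assms(2,3)
proof (induction u rule: length_induct)
  case (1 u)
  have n3: "3 \<le> n" using n by simp
  \<comment> \<open>The image word is trivial, so it fixes the empty word.\<close>
  have "trace_eq (foldr push (twin_sets n id u) []) []"
    using cactus_sets_word_eq[OF 1(3)] by (force simp: twin_sets_def)
  then have nil: "foldr push (twin_sets n id u) [] = []"
    using trace_eq_length by force
  show ?case
  proof (cases "reduced (twin_sets n id u)")
    case True
    from foldr_push_reduced[OF this] nil have "twin_sets n id u = []" by simp
    then have "u = []" by (cases u) (auto simp: twin_sets_Cons[OF n])
    then show ?thesis by (simp add: twin_eq_refl)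
  next
    case False
    from shorten_twin_word[OF n _ 1(2) this] obtain u' where
      u': "twin_eq n u u'" "length u' < length u" by auto
    have w: "u' \<in> words (twin_gens n)" using twin_eq_words[OF u'(1)] by simp
    \<comment> \<open>Passing through classes shows that the shorter word also has trivial image, as
      the induction requires.\<close>
    have "word_rel (twin_gens n) (twin_rels n) `` {u} = word_rel (twin_gens n) (twin_rels n) `` {u'}"
      using word_class_eq_iff[OF twin_rels_words 1(2) w] u'(1) by (simp add: twin_eq_def)
    with kappa_class[OF n3 1(2)] kappa_class[OF n3 w]
    have "word_eq (cactus_gens n) (cactus_rels n) (kappa_word n u) (kappa_word n u')"
      using word_class_eq_iff[OF cactus_rels_words kappa_word_words[OF n3 1(2)]
          kappa_word_words[OF n3 w]] by simp
    then have "word_eq (cactus_gens n) (cactus_rels n) (kappa_word n u') []"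
      using 1(3) by (blast intro: word_eq.trans word_eq.sym)
    with 1(1) u'(2) w have "twin_eq n u' []" by blast
    with u'(1) show ?thesis by (rule twin_eq_trans)
  qed
qed

theorem theorem15:
  fixes n :: nat
  assumes "4 \<le> n"
  shows "kappa n \<in> hom (full_round_twin_group n) (full_cactus_group n)
    \<and> (\<forall>i. 1 \<le> i \<and> i \<le> n - 1 \<longrightarrow> kappa n (sigma n i) = cactus n i (i + 1))
    \<and> kappa n (zeta n) = cactus n 1 n \<otimes>\<^bsub>full_cactus_group n\<^esub> cactus n 2 n
    \<and> inj_on (kappa n) (carrier (full_round_twin_group n))"
proof -
  have n: "3 \<le> n" using assms by simp
  interpret group_hom "full_round_twin_group n" "full_cactus_group n" "kappa n"
    by (intro group_hom.intro group_hom_axioms.intro group_full_round_twin_group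
        group_full_cactus_group kappa_hom n)
  have "X = \<one>\<^bsub>full_round_twin_group n\<^esub>"
    if X: "X \<in> carrier (full_round_twin_group n)" "kappa n X = \<one>\<^bsub>full_cactus_group n\<^esub>" for X
  proof -
    obtain u where u: "u \<in> words (twin_gens n)" "X = word_rel (twin_gens n) (twin_rels n) `` {u}"
      using X(1) by (auto simp: full_round_twin_group_def carrier_presented_group)
    have "word_eq (cactus_gens n) (cactus_rels n) (kappa_word n u) []"
      using X(2) word_class_eq_iff[OF cactus_rels_words kappa_word_words[OF n u(1)] words_Nil]
      by (simp add: u(2) kappa_class[OF n u(1)] one_full_cactus_group)
    from kappa_word_eq_Nil[OF assms u(1) this] show ?thesis
      using word_class_eq_iff[OF twin_rels_words u(1) words_Nil]
      by (simp add: u(2) twin_eq_def full_round_twin_group_def one_presented_group)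
  qed
  then have "inj_on (kappa n) (carrier (full_round_twin_group n))"
    by (simp add: inj_on_one_iff)
  then show ?thesis
    using kappa_hom[OF n] kappa_sigma[OF n] kappa_zeta[OF n] by blast
qed

end
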